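(* Let $\ell\ge1$ be an integer. For $0\le m\le n$, the entry $d_{\ell,n}^m$ equals the cardinality of $D_{\ell,n}^m$, the set of $m$-isolated-fixed permutations in $G_{\ell,n}$.
   Context: Write $[n]=\{1,\dots,n\}$ (with $[0]=\emptyset$). For a fixed integer $\ell\ge1$, let $C_\ell$ be the cyclic group generated by $\zeta=e^{2i\pi/\ell}$. The group $G_{\ell,n}=C_\ell\wr S_n$ of colored permutations consists of the pairs $\pi=(\epsilon,\sigma)$ with $\epsilon=(\epsilon_1,\dots,\epsilon_n)\in C_\ell^n$ and $\sigma\in S_n$; $\pi$ is identified with the permutation of the colored set $\{\zeta^j i : i\in[n],\ 0\le j\le \ell-1\}$ (regarded as $C_\ell\times[n]$) given by $\pi(i)=\epsilon_{\sigma(i)}\sigma(i)$ and $\pi(\zeta^j i)=\zeta^j\pi(i)$ for $i\in[n]$. Write $|\pi|=\sigma$ and $\mathrm{sgn}_\pi(i)=\epsilon_i$ for $i\in[n]$. The cycles of $\pi$ are the cycles of $|\pi|$ on $[n]$, in which each letter $i$ is written with its color $\mathrm{sgn}_\pi(i)$. $\mathrm{FIX}(\pi)=\{i\in[n]:\pi(i)=i\}$ is the set of fixed points (the equality requires the letter to be uncolored, i.e. of color $1$). For $0\le m\le n$, $\pi\in G_{\ell,n}$ is called $m$-isolated-fixed if: (i) $\mathrm{sgn}_\pi(i)=1$ for all $i\in[m]$; (ii) $\mathrm{FIX}(\pi)\subseteq[m]$; (iii) each cycle of $\pi$ has at most one point in common with $[m]$. $D_{\ell,n}^m$ is the set of such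 permutations. The table $(g_{\ell,n}^m)_{0\le m\le n}$ is defined by $g_{\ell,n}^n=\ell^n n!$ and $g_{\ell,n}^m=g_{\ell,n}^{m+1}-g_{\ell,n-1}^m$ for $0\le m\le n-1$, and $d_{\ell,n}^m=g_{\ell,n}^m/(\ell^m m!)$; equivalently $d_{\ell,n}^n=1$ and $d_{\ell,n}^m=\ell(m+1)d_{\ell,n}^{m+1}-d_{\ell,n-1}^m$ for $0\le m\le n-1$. *)

theory Defs
  imports Complex_Main "HOL-Library.FuncSet" "HOL-Combinatorics.Combinatorics"
begin

definition zeta :: "nat \<Rightarrow> complex" where
  "zeta l = exp (2 * \<i> * of_real pi / of_nat l)"

definition colors :: "nat \<Rightarrow> complex set" where
  "colors l = {zeta l ^ j | j. j < l}"

(* Pairs (eps, sigma). Since eps is extensional and sigma is the identity off {1..n},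
   each colored permutation is represented exactly once. *)
definition colored_perms :: "nat \<Rightarrow> nat \<Rightarrow> ((nat \<Rightarrow> complex) \<times> (nat \<Rightarrow> nat)) set" where
  "colored_perms l n = ({1..n} \<rightarrow>\<^sub>E colors l) \<times> {\<sigma>. \<sigma> permutes {1..n}}"

definition sgn_cp :: "(nat \<Rightarrow> complex) \<times> (nat \<Rightarrow> nat) \<Rightarrow> nat \<Rightarrow> complex" where
  "sgn_cp \<pi> = fst \<pi>"

definition abs_cp :: "(nat \<Rightarrow> complex) \<times> (nat \<Rightarrow> nat) \<Rightarrow> nat \<Rightarrow> nat" where
  "abs_cp \<pi> = snd \<pi>"

(* The colored letter c i is the pair (c, i), and the uncolored letter i is (1, i).
   The color picked up is that of the image sigma(i), not that of i. *)
definition act_cp ::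
    "(nat \<Rightarrow> complex) \<times> (nat \<Rightarrow> nat) \<Rightarrow> complex \<times> nat \<Rightarrow> complex \<times> nat" where
  "act_cp \<pi> = (\<lambda>(c, i). (c * sgn_cp \<pi> (abs_cp \<pi> i), abs_cp \<pi> i))"

definition FIX :: "nat \<Rightarrow> (nat \<Rightarrow> complex) \<times> (nat \<Rightarrow> nat) \<Rightarrow> nat set" where
  "FIX n \<pi> = {i \<in> {1..n}. act_cp \<pi> (1, i) = (1, i)}"

(* Cycles as sets of letters; fixed letters of the underlying permutation
   give singleton cycles. *)
definition cycles_cp :: "nat \<Rightarrow> (nat \<Rightarrow> complex) \<times> (nat \<Rightarrow> nat) \<Rightarrow> nat set set" where
  "cycles_cp n \<pi> = orbit (abs_cp \<pi>) ` {1..n}"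

definition isolated_fixed :: "nat \<Rightarrow> nat \<Rightarrow> (nat \<Rightarrow> complex) \<times> (nat \<Rightarrow> nat) \<Rightarrow> bool" where
  "isolated_fixed n m \<pi> \<longleftrightarrow>
     (\<forall>i \<in> {1..m}. sgn_cp \<pi> i = 1) \<and>
     FIX n \<pi> \<subseteq> {1..m} \<and>
     (\<forall>c \<in> cycles_cp n \<pi>. card (c \<inter> {1..m}) \<le> 1)"

definition isolated_fixed_perms ::
    "nat \<Rightarrow> nat \<Rightarrow> nat \<Rightarrow> ((nat \<Rightarrow> complex) \<times> (nat \<Rightarrow> nat)) set" where
  "isolated_fixed_perms l n m = {\<pi> \<in> colored_perms l n. isolated_fixed n m \<pi>}"

(* The table is only meaningful for m \<le> n; the value 0 elsewhere is arbitrary and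
   never enters the recursion for an entry with m \<le> n. *)
function g_entry :: "nat \<Rightarrow> nat \<Rightarrow> nat \<Rightarrow> int" where
  "g_entry l n m =
     (if m = n then int l ^ n * fact n
      else if m < n then g_entry l n (m + 1) - g_entry l (n - 1) m
      else 0)"
  by auto
termination by (relation "measure (\<lambda>(l, n, m). n - m)") auto

declare g_entry.simps [simp del]

definition d_entry :: "nat \<Rightarrow> nat \<Rightarrow> nat \<Rightarrow> rat" where
  "d_entry l n m = of_int (g_entry l n m) / (of_nat l ^ m * fact m)"

lemma d_entry_diag: "l \<ge> 1 \<Longrightarrow> d_entry l n n = 1"
  by (simp add: d_entry_def g_entry.simps)

lemma d_entry_rec:
  assumes "l \<ge> 1" "m < n"
  shows "d_entry l n m = of_nat l * of_nat (m + 1) * d_entry l n (m + 1) - d_entry l (n - 1) m"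
proof -
  have "g_entry l n m = g_entry l n (m + 1) - g_entry l (n - 1) m"
    using assms(2) by (subst g_entry.simps) simp
  moreover have "of_nat l * of_nat (m + 1) * d_entry l n (m + 1)
      = of_int (g_entry l n (m + 1)) / (of_nat l ^ m * fact m)"
    using assms(1) by (simp add: d_entry_def divide_simps)
  ultimately show ?thesis
    by (simp add: d_entry_def diff_divide_distrib)
qed

lemma finite_colored_perms: "finite (colored_perms l n)"
proof -
  have "finite (colors l)" by (simp add: colors_def)
  then show ?thesis
    by (simp add: colored_perms_def finite_PiE finite_permutations)
qed

end

theory Submission
  imports Defs
begin

text \<open>
  The idea is to separate the two roles that the letters play. For a finite set \<open>S\<close> of letters
  and disjoint subsets \<open>M\<close> and \<open>T\<close>, consider the colored permutations of \<open>S\<close> in which the letters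
  of \<open>M\<close> are uncolored and lie in distinct cycles, and no letter of \<open>T\<close> is an uncolored fixed
  point. The permutations to be counted are the case \<open>S = {1..n}\<close>, \<open>M = {1..m}\<close>, \<open>T = {m+1..n}\<close>.
  With \<open>M\<close> held fixed, the number of such permutations obeys the recursion of the table in the
  size of \<open>T\<close>.

  Without forbidden fixed points the number is \<open>l^(|S| - |M|) |S|! / |M|!\<close>: starting from the
  identity on \<open>M\<close>, the other letters are inserted one at a time. A new letter joins
  a cycle just before one of the \<open>s\<close> letters present, or forms a cycle by itself, and takes
  one of \<open>l\<close> colors; in none of these \<open>l (s + 1)\<close> cases do two cycles merge
  (\<open>card_isolating_insert\<close>). Multiplied by \<open>l^|M| |M|!\<close> this gives \<open>l^|S| |S|!\<close>, the diagonal entry.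

  Forbidding one more uncolored fixed point \<open>x\<close> removes the permutations that fix \<open>x\<close> without
  color, and erasing \<open>x\<close> turns them into the permutations of \<open>S - {x}\<close> with the same
  \<open>M\<close> and \<open>T\<close> (\<open>card_isolating_forbid\<close>). This is \<open>g(n, m) = g(n, m + 1) - g(n - 1, m)\<close>,
  where \<open>|T| = n - m\<close> counts the distance to the diagonal (\<open>card_isolating_eq_g_entry\<close>).
\<close>

section \<open>Permutations that separate a set of letters\<close>

definition separates :: "('a \<Rightarrow> 'a) \<Rightarrow> 'a set \<Rightarrow> bool" where
  "separates \<sigma> M \<longleftrightarrow> (\<forall>i\<in>M. \<forall>j\<in>M. j \<in> orbit \<sigma> i \<longrightarrow> i = j)"

text \<open>
  Orbits of a permutation of finite support are equivalence classes, so two letters of one cycle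
  reach each other.
\<close>

lemma separates_iff_card_orbit_le_1:
  assumes \<sigma>: "\<sigma> permutes S" and fin: "finite S" and MS: "M \<subseteq> S"
  shows "separates \<sigma> M \<longleftrightarrow> (\<forall>c \<in> orbit \<sigma> ` S. card (c \<inter> M) \<le> 1)"
proof
  have perm: "permutation \<sigma>"
    using \<sigma> fin by (auto simp: permutation_permutes)
  have finM: "finite M"
    using fin MS finite_subset by blast
  {
    assume sep: "separates \<sigma> M"
    show "\<forall>c \<in> orbit \<sigma> ` S. card (c \<inter> M) \<le> 1"
    proof
      fix c assume "c \<in> orbit \<sigma> ` S"
      then obtain k where c: "c = orbit \<sigma> k" by auto
      have "i = j" if "i \<in> c \<inter> M" "j \<in> c \<inter> M" for i j
      proof -
        have "i \<in> orbit \<sigma> k" "j \<in> orbit \<sigma> k" using that c by auto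
        then have "j \<in> orbit \<sigma> i"
          using orbit_trans orbit_swap permutation_self_in_orbit[OF perm] by metis
        then show ?thesis using sep that by (auto simp: separates_def)
      qed
      then show "card (c \<inter> M) \<le> 1"
        using finM by (subst One_nat_def, subst card_le_Suc0_iff_eq) auto
    qed
  next
    assume small: "\<forall>c \<in> orbit \<sigma> ` S. card (c \<inter> M) \<le> 1"
    show "separates \<sigma> M"
      unfolding separates_def
    proof (intro ballI impI)
      fix i j assume ij: "i \<in> M" "j \<in> M" "j \<in> orbit \<sigma> i"
      have "card (orbit \<sigma> i \<inter> M) \<le> Suc 0" using small MS ij by auto
      moreover have "i \<in> orbit \<sigma> i" using perm by (rule permutation_self_in_orbit)
      ultimately show "i = j"
        using ij finM by (subst (asm) card_le_Suc0_iff_eq) auto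
    qed
  }
qed

lemma separates_support_iff_id:
  assumes "\<sigma> permutes M"
  shows "separates \<sigma> M \<longleftrightarrow> \<sigma> = id"
proof
  assume "separates \<sigma> M"
  then have "i = \<sigma> i" if "i \<in> M" for i
    using that orbit.base[of \<sigma> i] permutes_in_image[OF assms, of i] by (simp add: separates_def)
  then show "\<sigma> = id"
    using permutes_not_in[OF assms] by (metis eq_id_iff)
next
  have "j = i" if "j \<in> orbit id i" for i j :: 'a
    using that by induction auto
  then show "separates \<sigma> M" if "\<sigma> = id"
    using that by (auto simp: separates_def)
qed

text \<open>
  Composing with \<open>transpose x b\<close> inserts \<open>x\<close> just before \<open>b\<close> in the cycle of \<open>b\<close>, so the
  old letters are visited in the same cyclic order as before.
\<close>

lemma orbit_transpose_comp_iff: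
  assumes q: "q permutes S" and x: "x \<notin> S" and y: "y \<in> S" and z: "z \<in> S"
  shows "z \<in> orbit (transpose x b \<circ> q) y \<longleftrightarrow> z \<in> orbit q y"
proof -
  define p where "p = transpose x b \<circ> q"
  have qx: "q x = x" using q x by (rule permutes_not_in)
  have qS: "q u \<in> S \<longleftrightarrow> u \<in> S" for u using q by (rule permutes_in_image)
  have px: "p x = b" by (simp add: p_def qx)
  have p_other: "p u = (if q u = b then x else q u)" if "u \<noteq> x" for u
    using that qx injD[OF permutes_inj[OF q], of u x] by (auto simp: p_def transpose_def)
  \<comment> \<open>While the \<open>p\<close>-orbit visits the inserted letter \<open>x\<close>, the \<open>q\<close>-orbit has already moved on to \<open>b\<close>.\<close>
  have to_q: "if w = x then b \<in> orbit q y else w \<in> orbit q y" if "w \<in> orbit p y" for w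
    using that
  proof induction
    case base
    have "y \<noteq> x" using x y by auto
    moreover have "q y \<in> orbit q y" by (rule orbit.base)
    moreover have "q y \<noteq> x" using qS x y by metis
    ultimately show ?case using p_other by metis
  next
    case (step w)
    show ?case
    proof (cases "w = x")
      case True
      then show ?thesis using step px by auto
    next
      case False
      then have "q w \<in> orbit q y" using step by (auto intro: orbit.step)
      moreover have "q w \<noteq> x" using False qx q permutes_inj by (metis injD)
      ultimately show ?thesis using False p_other by metis
    qed
  qed
  \<comment> \<open>One step of \<open>q\<close> is one step of \<open>p\<close>, or two steps when \<open>p\<close> makes the detour through \<open>x\<close>.\<close>
  have p_step: "q u \<in> orbit p u" if "u \<in> S" for u
  proof (cases "q u = b")
    case True
    have "p u = x" using True p_other that x by metis
    then have "p (p u) = q u" using True px by simp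
    then show ?thesis by (metis orbit.base orbit.step)
  next
    case False
    then have "p u = q u" using p_other that x by metis
    then show ?thesis by (metis orbit.base)
  qed
  have to_p: "w \<in> orbit p y \<and> w \<in> S" if "w \<in> orbit q y" for w
    using that
  proof induction
    case base
    then show ?case using p_step y qS by auto
  next
    case (step w)
    then show ?case using p_step[of w] qS orbit_trans by metis
  qed
  show ?thesis
    using to_q[of z] to_p[of z] x z unfolding p_def by metis
qed

lemma separates_transpose_comp_iff:
  assumes "q permutes S" "x \<notin> S" "M \<subseteq> S"
  shows "separates (transpose x b \<circ> q) M \<longleftrightarrow> separates q M"
proof -
  have "j \<in> orbit (transpose x b \<circ> q) i \<longleftrightarrow> j \<in> orbit q i" if "i \<in> M" "j \<in> M" for i j
    using assms that by (intro orbit_transpose_comp_iff[of q S]) auto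
  then show ?thesis unfolding separates_def by metis
qed

section \<open>Counting by insertion and deletion of a letter\<close>

text \<open>
  The letters of \<open>M\<close> are uncolored and isolated from each other, and those of \<open>T\<close> are barred from
  being uncolored fixed points. Keeping \<open>S\<close>, \<open>M\<close> and \<open>T\<close> apart lets \<open>S\<close> and \<open>T\<close> shrink
  by an arbitrary letter without renumbering the others.
\<close>

definition isolating :: "'c::one set \<Rightarrow> 'a set \<Rightarrow> 'a set \<Rightarrow> 'a set \<Rightarrow> (('a \<Rightarrow> 'c) \<times> ('a \<Rightarrow> 'a)) set" where
  "isolating C S M T = {(\<epsilon>, \<sigma>). \<epsilon> \<in> S \<rightarrow>\<^sub>E C \<and> \<sigma> permutes S \<and> (\<forall>i\<in>M. \<epsilon> i = 1) \<and>
     (\<forall>i\<in>T. \<not> (\<sigma> i = i \<and> \<epsilon> i = 1)) \<and> separates \<sigma> M}"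

lemma finite_isolating:
  assumes "finite C" "finite S"
  shows "finite (isolating C S M T)"
proof (rule finite_subset)
  show "isolating C S M T \<subseteq> (S \<rightarrow>\<^sub>E C) \<times> {\<sigma>. \<sigma> permutes S}"
    by (auto simp: isolating_def)
  show "finite ((S \<rightarrow>\<^sub>E C) \<times> {\<sigma>. \<sigma> permutes S})"
    using assms by (simp add: finite_PiE finite_permutations)
qed

lemma card_isolating_self:
  fixes C :: "'c::one set"
  assumes "1 \<in> C"
  shows "card (isolating C M M {}) = 1"
proof -
  have "isolating C M M {} = {(\<lambda>i\<in>M. 1, id)}"
  proof (rule set_eqI, clarify)
    fix \<epsilon> :: "'a \<Rightarrow> 'c" and \<sigma> :: "'a \<Rightarrow> 'a"
    have "\<epsilon> \<in> M \<rightarrow>\<^sub>E C \<and> (\<forall>i\<in>M. \<epsilon> i = 1) \<longleftrightarrow> \<epsilon> = (\<lambda>i\<in>M. 1)"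
      using assms by (auto simp: fun_eq_iff PiE_def extensional_def)
    moreover have "\<sigma> permutes M \<and> separates \<sigma> M \<longleftrightarrow> \<sigma> = id"
      using separates_support_iff_id permutes_id by metis
    ultimately show "(\<epsilon>, \<sigma>) \<in> isolating C M M {} \<longleftrightarrow> (\<epsilon>, \<sigma>) \<in> {(\<lambda>i\<in>M. 1, id)}"
      by (auto simp: isolating_def)
  qed
  then show ?thesis by simp
qed

text \<open>
  A colored permutation of \<open>insert x S\<close> is determined by the color \<open>c\<close> of \<open>x\<close>, the image \<open>b\<close> of
  \<open>x\<close>, and what remains when \<open>x\<close> is taken out of its cycle.
\<close>

lemma card_isolating_insert:
  fixes C :: "'c::one set"
  assumes fin: "finite S" and x: "x \<notin> S" and MS: "M \<subseteq> S"
  shows "card (isolating C (insert x S) M {}) = card C * Suc (card S) * card (isolating C S M {})"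
proof -
  let ?ins = "\<lambda>((c, b), (\<epsilon>, \<sigma>)). (\<epsilon>(x := c), transpose x b \<circ> \<sigma>)"
  let ?D = "(C \<times> insert x S) \<times> isolating C S M {}"
  have xM: "x \<notin> M" using x MS by auto
  have inj: "inj_on ?ins ?D"
  proof (rule inj_onI)
    fix u v assume uv: "u \<in> ?D" "v \<in> ?D" "?ins u = ?ins v"
    obtain c b \<epsilon> \<sigma> where u: "u = ((c, b), (\<epsilon>, \<sigma>))" by (metis surj_pair)
    obtain c' b' \<epsilon>' \<sigma>' where v: "v = ((c', b'), (\<epsilon>', \<sigma>'))" by (metis surj_pair)
    have mem: "(\<epsilon>, \<sigma>) \<in> isolating C S M {}" "(\<epsilon>', \<sigma>') \<in> isolating C S M {}"
      and eps: "\<epsilon>(x := c) = \<epsilon>'(x := c')"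
      and sig: "transpose x b \<circ> \<sigma> = transpose x b' \<circ> \<sigma>'"
      using uv by (simp_all add: u v)
    \<comment> \<open>The old permutations fix \<open>x\<close>, so \<open>b\<close> is recovered as the image of \<open>x\<close>.\<close>
    have fix_x: "\<sigma> x = x" "\<sigma>' x = x" and undef: "\<epsilon> x = undefined" "\<epsilon>' x = undefined"
      using mem x by (auto simp: isolating_def permutes_def PiE_def extensional_def)
    have c: "c = c'" using fun_cong[OF eps, of x] by simp
    have "\<epsilon> = \<epsilon>'"
    proof
      fix i show "\<epsilon> i = \<epsilon>' i" using fun_cong[OF eps, of i] undef by (cases "i = x") auto
    qed
    moreover have b: "b = b'" using fun_cong[OF sig, of x] fix_x by simp
    moreover have "\<sigma> = \<sigma>'"
      using sig b by (metis comp_assoc transpose_comp_involutory id_comp)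
    ultimately show "u = v" using c by (simp add: u v)
  qed
  have image: "?ins ` ?D = isolating C (insert x S) M {}"
  proof (intro equalityI subsetI)
    fix \<pi> assume "\<pi> \<in> ?ins ` ?D"
    then obtain c b \<epsilon> \<sigma> where \<pi>: "\<pi> = (\<epsilon>(x := c), transpose x b \<circ> \<sigma>)"
      and c: "c \<in> C" and b: "b \<in> insert x S" and mem: "(\<epsilon>, \<sigma>) \<in> isolating C S M {}"
      by auto
    have \<sigma>: "\<sigma> permutes S" and sep: "separates \<sigma> M" and \<epsilon>: "\<epsilon> \<in> S \<rightarrow>\<^sub>E C"
      and one: "\<forall>i\<in>M. \<epsilon> i = 1"
      using mem by (auto simp: isolating_def)
    have "\<epsilon>(x := c) \<in> insert x S \<rightarrow>\<^sub>E C" using c \<epsilon> by (rule PiE_fun_upd)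
    moreover have "transpose x b \<circ> \<sigma> permutes insert x S"
      using \<sigma> b by (intro permutes_compose permutes_swap_id permutes_subset[OF \<sigma>]) auto
    moreover have "separates (transpose x b \<circ> \<sigma>) M"
      using sep separates_transpose_comp_iff[OF \<sigma> x MS] by simp
    ultimately show "\<pi> \<in> isolating C (insert x S) M {}"
      using one xM unfolding \<pi> isolating_def by auto
  next
    fix \<pi> assume mem: "\<pi> \<in> isolating C (insert x S) M {}"
    obtain \<epsilon> \<tau> where \<pi>: "\<pi> = (\<epsilon>, \<tau>)" by (cases \<pi>)
    have \<epsilon>: "\<epsilon> \<in> insert x S \<rightarrow>\<^sub>E C" and \<tau>: "\<tau> permutes insert x S" and sep: "separates \<tau> M"
      and one: "\<forall>i\<in>M. \<epsilon> i = 1"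
      using mem by (auto simp: \<pi> isolating_def)
    obtain b \<sigma> where b: "b \<in> insert x S" and \<sigma>: "\<sigma> permutes S" and \<tau>_eq: "\<tau> = transpose x b \<circ> \<sigma>"
      using \<tau> permutes_insert[of x S] by fast
    obtain c \<delta> where c: "c \<in> C" and \<delta>: "\<delta> \<in> S \<rightarrow>\<^sub>E C" and \<epsilon>_eq: "\<epsilon> = \<delta>(x := c)"
      using \<epsilon> by (auto simp: PiE_insert_eq)
    have "\<forall>i\<in>M. \<delta> i = 1" using one xM \<epsilon>_eq by (metis fun_upd_other)
    moreover have "separates \<sigma> M"
      using sep separates_transpose_comp_iff[OF \<sigma> x MS] \<tau>_eq by simp
    ultimately have "((c, b), (\<delta>, \<sigma>)) \<in> ?D"
      using b c \<delta> \<sigma> by (auto simp: isolating_def)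
    then show "\<pi> \<in> ?ins ` ?D"
      by (rule rev_image_eqI) (simp add: \<pi> \<tau>_eq \<epsilon>_eq)
  qed
  have "card (isolating C (insert x S) M {}) = card ?D"
    unfolding image[symmetric] using inj by (rule card_image)
  then show ?thesis using fin x by (simp add: card_cartesian_product)
qed

lemma card_isolating_unrestricted:
  fixes C :: "'c::one set"
  assumes one: "1 \<in> C" and fin: "finite S" and MS: "M \<subseteq> S"
  shows "card (isolating C S M {}) * (card C ^ card M * fact (card M)) = card C ^ card S * fact (card S)"
proof -
  have finM: "finite M" using fin MS by (rule finite_subset[rotated])
  have "card (isolating C (M \<union> R) M {}) * (card C ^ card M * fact (card M))
      = card C ^ card (M \<union> R) * fact (card (M \<union> R))" if "finite R" "R \<inter> M = {}" for R
    using that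
  proof (induction R rule: finite_induct)
    case empty
    then show ?case using card_isolating_self[OF one, of M] by simp
  next
    case (insert x R)
    let ?S = "M \<union> R"
    have fin': "finite ?S" and x: "x \<notin> ?S"
      using insert finM by auto
    have "card (isolating C (insert x ?S) M {}) * (card C ^ card M * fact (card M))
        = card C * Suc (card ?S) * (card (isolating C ?S M {}) * (card C ^ card M * fact (card M)))"
      using card_isolating_insert[OF fin' x, of M C] by simp
    also have "\<dots> = card C * Suc (card ?S) * (card C ^ card ?S * fact (card ?S))"
      using insert by simp
    also have "\<dots> = card C ^ card (insert x ?S) * fact (card (insert x ?S))"
      using fin' x by (simp add: algebra_simps)
    finally show ?case by simp
  qed
  from this[of "S - M"] show ?thesis
    using fin MS by (auto simp: Un_absorb1)
qed

lemma card_isolating_forbid: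
  fixes C :: "'c::one set"
  assumes one: "1 \<in> C" and finC: "finite C" and fin: "finite S" and x: "x \<notin> S"
    and MS: "M \<subseteq> S" and TS: "T \<subseteq> S"
  shows "card (isolating C (insert x S) M (insert x T)) + card (isolating C S M T)
    = card (isolating C (insert x S) M T)"
proof -
  let ?F = "{(\<epsilon>, \<sigma>) \<in> isolating C (insert x S) M T. \<sigma> x = x \<and> \<epsilon> x = 1}"
  let ?ins = "\<lambda>(\<epsilon>, \<sigma>). (\<epsilon>(x := 1), \<sigma>)"
  have xMT: "x \<notin> M" "x \<notin> T" using x MS TS by auto
  have inj: "inj_on ?ins (isolating C S M T)"
  proof (rule inj_onI)
    fix u v assume uv: "u \<in> isolating C S M T" "v \<in> isolating C S M T" "?ins u = ?ins v"
    obtain \<epsilon> \<sigma> where u: "u = (\<epsilon>, \<sigma>)" by (cases u)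
    obtain \<epsilon>' where v: "v = (\<epsilon>', \<sigma>)" using uv(3) by (cases v) (simp add: u)
    have mem: "(\<epsilon>, \<sigma>) \<in> isolating C S M T" "(\<epsilon>', \<sigma>) \<in> isolating C S M T"
      and eps: "\<epsilon>(x := 1) = \<epsilon>'(x := 1)"
      using uv by (simp_all add: u v)
    have undef: "\<epsilon> x = undefined" "\<epsilon>' x = undefined"
      using mem x by (auto simp: isolating_def PiE_def extensional_def)
    have "\<epsilon> = \<epsilon>'"
    proof
      fix i show "\<epsilon> i = \<epsilon>' i" using fun_cong[OF eps, of i] undef by (cases "i = x") auto
    qed
    then show "u = v" by (simp add: u v)
  qed
  have image: "?ins ` isolating C S M T = ?F"
  proof (intro equalityI subsetI)
    fix \<pi> assume "\<pi> \<in> ?ins ` isolating C S M T"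
    then obtain \<epsilon> \<sigma> where \<pi>: "\<pi> = (\<epsilon>(x := 1), \<sigma>)" and mem: "(\<epsilon>, \<sigma>) \<in> isolating C S M T"
      by auto
    have \<sigma>: "\<sigma> permutes S" and \<epsilon>: "\<epsilon> \<in> S \<rightarrow>\<^sub>E C" using mem by (auto simp: isolating_def)
    have "\<epsilon>(x := 1) \<in> insert x S \<rightarrow>\<^sub>E C" using one \<epsilon> by (rule PiE_fun_upd)
    moreover have "\<sigma> permutes insert x S" using \<sigma> by (rule permutes_subset) auto
    moreover have "\<sigma> x = x" using \<sigma> x by (rule permutes_not_in)
    ultimately show "\<pi> \<in> ?F"
      using mem xMT by (auto simp: \<pi> isolating_def)
  next
    fix \<pi> assume "\<pi> \<in> ?F"
    then obtain \<epsilon> \<sigma> where \<pi>: "\<pi> = (\<epsilon>, \<sigma>)" and mem: "(\<epsilon>, \<sigma>) \<in> isolating C (insert x S) M T"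
      and \<sigma>x: "\<sigma> x = x" and \<epsilon>x: "\<epsilon> x = 1"
      by auto
    have \<sigma>: "\<sigma> permutes insert x S" and \<epsilon>: "\<epsilon> \<in> insert x S \<rightarrow>\<^sub>E C"
      using mem by (auto simp: isolating_def)
    have "\<sigma> permutes S"
      using \<sigma> \<sigma>x by (auto intro: permutes_superset)
    moreover obtain c \<delta> where \<delta>: "\<delta> \<in> S \<rightarrow>\<^sub>E C" and \<epsilon>_eq: "\<epsilon> = \<delta>(x := c)"
      using \<epsilon> by (auto simp: PiE_insert_eq)
    moreover have "\<delta> i = \<epsilon> i" if "i \<in> M \<union> T" for i
      using that xMT \<epsilon>_eq by auto
    ultimately have "(\<delta>, \<sigma>) \<in> isolating C S M T"
      using mem by (auto simp: isolating_def)
    moreover have "\<pi> = ?ins (\<delta>, \<sigma>)" using \<epsilon>x by (auto simp: \<pi> \<epsilon>_eq)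
    ultimately show "\<pi> \<in> ?ins ` isolating C S M T" by (rule rev_image_eqI)
  qed
  have cardF: "card ?F = card (isolating C S M T)"
    unfolding image[symmetric] using inj by (rule card_image)
  have split: "isolating C (insert x S) M T = isolating C (insert x S) M (insert x T) \<union> ?F"
    by (auto simp: isolating_def)
  have "finite (isolating C (insert x S) M U)" for U
    using finC fin by (intro finite_isolating) auto
  moreover from this have "finite ?F"
    by (rule finite_subset[rotated]) auto
  moreover have "isolating C (insert x S) M (insert x T) \<inter> ?F = {}"
    by (auto simp: isolating_def)
  ultimately have "card (isolating C (insert x S) M (insert x T) \<union> ?F)
      = card (isolating C (insert x S) M (insert x T)) + card ?F"
    by (intro card_Un_disjoint)
  then show ?thesis using cardF arg_cong[OF split, of card] by linarith
qed

text \<open>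
  The factor \<open>l^|M| |M|!\<close> stays constant along the recursion: it depends on \<open>l\<close> and \<open>M\<close> alone, whereas the
  column index \<open>|S| - |T|\<close> of the table moves with \<open>T\<close>. So the identity passes from \<open>T\<close> to
  \<open>insert x T\<close> for every \<open>S\<close> at once.
\<close>

lemma card_isolating_eq_g_entry:
  fixes C :: "'c::one set"
  assumes one: "1 \<in> C" and finC: "finite C"
    and fin: "finite S" and MS: "M \<subseteq> S" and TS: "T \<subseteq> S - M"
  shows "int (card (isolating C S M T)) * (int (card C) ^ card M * fact (card M))
    = g_entry (card C) (card S) (card S - card T)"
proof -
  have "finite T" using TS fin by (meson finite_Diff finite_subset)
  then show ?thesis using fin MS TS
  proof (induction T arbitrary: S rule: finite_induct)
    case empty
    have "int (card (isolating C S M {}) * (card C ^ card M * fact (card M)))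
        = int (card C ^ card S * fact (card S))"
      using card_isolating_unrestricted[OF one empty(1,2)] by presburger
    then show ?case by (simp add: g_entry.simps)
  next
    case (insert x T)
    define S' where "S' = S - {x}"
    have S: "S = insert x S'" and x: "x \<notin> S'" and fin': "finite S'"
      and MS': "M \<subseteq> S'" and TS': "T \<subseteq> S' - M" "T \<subseteq> S'"
      using insert.prems insert.hyps by (auto simp: S'_def)
    define k where "k = card S - card (insert x T)"
    have cardS: "card S = Suc (card S')" using S x fin' by simp
    have "card (insert x T) = Suc (card T)" using insert.hyps by simp
    moreover have "card T \<le> card S'" using TS' fin' by (intro card_mono) auto
    ultimately have k: "k < card S" "card S - card T = k + 1" "card S' - card T = k"
      using cardS by (auto simp: k_def)
    let ?w = "int (card C) ^ card M * fact (card M)"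
    have "int (card (isolating C S M (insert x T)))
        = int (card (isolating C S M T)) - int (card (isolating C S' M T))"
      using card_isolating_forbid[OF one finC fin' x MS' TS'(2)] unfolding S by linarith
    then have "int (card (isolating C S M (insert x T))) * ?w
        = int (card (isolating C S M T)) * ?w - int (card (isolating C S' M T)) * ?w"
      by (simp only: left_diff_distrib)
    also have "\<dots> = g_entry (card C) (card S) (card S - card T)
        - g_entry (card C) (card S') (card S' - card T)"
      using insert.IH[of S] insert.IH[of S'] insert.prems fin' MS' TS' by simp
    also have "\<dots> = g_entry (card C) (card S) k"
      using k cardS by (subst (3) g_entry.simps) simp
    finally show ?case unfolding k_def .
  qed
qed

section \<open>Roots of unity as colors\<close>

lemma colors_eq_roots_unity:
  assumes "l \<ge> 1"
  shows "colors l = {z. z ^ l = 1}"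
proof -
  have "zeta l ^ j = cis (2 * pi * real j / real l)" for j
    by (simp add: zeta_def exp_of_nat_mult[symmetric] cis_conv_exp field_simps)
  then have "colors l = (\<lambda>j. cis (2 * pi * real j / real l)) ` {..<l}"
    by (auto simp: colors_def)
  then show ?thesis
    using bij_betw_roots_unity[of l] assms by (simp add: bij_betw_def)
qed

lemma isolated_fixed_perms_eq_isolating:
  assumes "m \<le> n"
  shows "isolated_fixed_perms l n m = isolating (colors l) {1..n} {1..m} ({1..n} - {1..m})"
proof (rule set_eqI, clarify)
  fix \<epsilon> :: "nat \<Rightarrow> complex" and \<sigma> :: "nat \<Rightarrow> nat"
  show "(\<epsilon>, \<sigma>) \<in> isolated_fixed_perms l n m \<longleftrightarrow>
    (\<epsilon>, \<sigma>) \<in> isolating (colors l) {1..n} {1..m} ({1..n} - {1..m})"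
  proof (cases "\<sigma> permutes {1..n}")
    case True
    have "FIX n (\<epsilon>, \<sigma>) = {i \<in> {1..n}. \<sigma> i = i \<and> \<epsilon> i = 1}"
      by (auto simp: FIX_def act_cp_def sgn_cp_def abs_cp_def)
    then have fixes_iff: "FIX n (\<epsilon>, \<sigma>) \<subseteq> {1..m} \<longleftrightarrow>
        (\<forall>i \<in> {1..n} - {1..m}. \<not> (\<sigma> i = i \<and> \<epsilon> i = 1))"
      by blast
    have "(\<forall>c \<in> cycles_cp n (\<epsilon>, \<sigma>). card (c \<inter> {1..m}) \<le> 1) \<longleftrightarrow> separates \<sigma> {1..m}"
      using separates_iff_card_orbit_le_1[OF True, of "{1..m}"] assms
      by (simp add: cycles_cp_def abs_cp_def)
    then show ?thesis
      using True fixes_iff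
      by (simp add: isolated_fixed_perms_def colored_perms_def isolated_fixed_def isolating_def sgn_cp_def)
  qed (simp add: isolated_fixed_perms_def colored_perms_def isolating_def)
qed

theorem theorem12:
  fixes l n m :: nat
  assumes "l \<ge> 1" and "m \<le> n"
  shows "d_entry l n m = of_nat (card (isolated_fixed_perms l n m))"
proof -
  have roots: "colors l = {z. z ^ l = 1}" using assms(1) by (rule colors_eq_roots_unity)
  have card_colors: "card (colors l) = l"
    using assms(1) card_roots_unity_eq[of l] by (simp add: roots)
  have "finite (colors l)" by (simp add: colors_def)
  moreover have "1 \<in> colors l" by (simp add: roots)
  moreover have "card ({1..n} - {1..m}) = n - m"
    using assms(2) by (subst card_Diff_subset) auto
  ultimately have "int (card (isolated_fixed_perms l n m)) * (int l ^ m * fact m) = g_entry l n m"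
    using card_isolating_eq_g_entry[of "colors l" "{1..n}" "{1..m}" "{1..n} - {1..m}"] assms
    by (simp add: isolated_fixed_perms_eq_isolating card_colors)
  then have "of_nat (card (isolated_fixed_perms l n m)) * (of_nat l ^ m * fact m)
      = (of_int (g_entry l n m) :: rat)"
    by (metis of_int_fact of_int_mult of_int_of_nat_eq of_int_power)
  then show ?thesis
    using assms(1) by (simp add: d_entry_def field_simps)
qed

end
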